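(* Let $\mathbb{M}_n$ be a Poisson manifold with local coordinates $z^i$ and nondegenerate Poisson tensor $\omega^{ij}(z)$, with bracket $\{A,B\}=\partial_iA\,\omega^{ij}\,\partial_jB$. Let $\Phi^\alpha(z)$, $\alpha=1,\dots,n-k$, be functionally independent functions such that $\triangle^{\alpha\beta}=\{\Phi^\alpha,\Phi^\beta\}$ satisfies $\det\triangle^{\alpha\beta}\ne0$ on $\mathbb{N}_k=\{\Phi^\alpha=0\}$, and let $\tilde\triangle_{\alpha\beta}$ be the inverse matrix of $\triangle^{\alpha\beta}$. Then the Dirac tensor $$\omega_D^{ij}=\{z^i,z^j\}-\{z^i,\Phi^\alpha\}\,\tilde\triangle_{\alpha\beta}\,\{\Phi^\beta,z^j\}$$ satisfies $\omega_D^{ip}\partial_p\omega_D^{jk}+\mathrm{cycle}(i,j,k)=0$, and hence the Dirac bracket $\{A,B\}_D=\partial_iA\,\omega_D^{ij}\,\partial_jB$ satisfies the Jacobi identity $$\{A,\{B,C\}_D\}_D+\mathrm{cycle}(A,B,C)=0$$ for all functions $A,B,C$.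
   Context: All objects are smooth, and all statements are local; the Dirac tensor is considered in a neighbourhood of $\mathbb{N}_k$ where $\triangle^{\alpha\beta}$ is invertible. Repeated indices are summed; $\mathrm{cycle}$ denotes the two remaining cyclic permutations. A Poisson tensor is a contravariant tensor $\omega^{ij}(z)$ with $\omega^{ij}=-\omega^{ji}$ and $\omega^{ip}\partial_p\omega^{jk}+\mathrm{cycle}(i,j,k)=0$; it is nondegenerate if $\det\omega\ne0$. Functions $\Phi^\alpha$, $\alpha=1,\dots,n-k$, are functionally independent if $\operatorname{rank}(\partial_i\Phi^\alpha)=n-k$. *)

theory Defs
  imports "HOL-Analysis.Analysis"
begin

text \<open>
  Everything is expressed in one coordinate chart, an open set \<open>U\<close> of \<open>real ^ 'n\<close>. Functions are
  total; only their values on the open set under consideration matter.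
\<close>

definition partial :: "'n \<Rightarrow> (real ^ 'n \<Rightarrow> real) \<Rightarrow> real ^ 'n \<Rightarrow> real" where
  "partial i f z = deriv (\<lambda>t. f (z + t *\<^sub>R axis i 1)) 0"

text \<open>Used only for open \<open>U\<close>, where \<open>partial\<close> looks at \<open>f\<close> inside \<open>U\<close> only.\<close>

primrec Ck_on :: "nat \<Rightarrow> (real ^ 'n) set \<Rightarrow> (real ^ 'n \<Rightarrow> real) \<Rightarrow> bool" where
  "Ck_on 0 U = (\<lambda>f. continuous_on U f)"
| "Ck_on (Suc k) U = (\<lambda>f. f differentiable_on U \<and> (\<forall>i. Ck_on k U (partial i f)))"

definition smooth_on :: "(real ^ 'n) set \<Rightarrow> (real ^ 'n \<Rightarrow> real) \<Rightarrow> bool" where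
  "smooth_on U f \<longleftrightarrow> (\<forall>k. Ck_on k U f)"

type_synonym 'n tensor2 = "real ^ 'n \<Rightarrow> real ^ 'n ^ 'n"

definition jacobi_tensor_at :: "'n tensor2 \<Rightarrow> real ^ 'n \<Rightarrow> bool" where
  "jacobi_tensor_at \<omega> z \<longleftrightarrow>
    (\<forall>i j k.
      (\<Sum>p\<in>UNIV. \<omega> z $ i $ p * partial p (\<lambda>y. \<omega> y $ j $ k) z)
    + (\<Sum>p\<in>UNIV. \<omega> z $ j $ p * partial p (\<lambda>y. \<omega> y $ k $ i) z)
    + (\<Sum>p\<in>UNIV. \<omega> z $ k $ p * partial p (\<lambda>y. \<omega> y $ i $ j) z) = 0)"

definition poisson_tensor_on :: "(real ^ 'n) set \<Rightarrow> 'n tensor2 \<Rightarrow> bool" where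
  "poisson_tensor_on U \<omega> \<longleftrightarrow>
    (\<forall>i j. smooth_on U (\<lambda>z. \<omega> z $ i $ j)) \<and>
    (\<forall>z\<in>U. \<forall>i j. \<omega> z $ i $ j = - \<omega> z $ j $ i) \<and>
    (\<forall>z\<in>U. jacobi_tensor_at \<omega> z)"

definition nondegenerate_on :: "(real ^ 'n) set \<Rightarrow> 'n tensor2 \<Rightarrow> bool" where
  "nondegenerate_on U \<omega> \<longleftrightarrow> (\<forall>z\<in>U. det (\<omega> z) \<noteq> 0)"

definition bracket ::
    "'n tensor2 \<Rightarrow> (real ^ 'n \<Rightarrow> real) \<Rightarrow> (real ^ 'n \<Rightarrow> real) \<Rightarrow> real ^ 'n \<Rightarrow> real" where
  "bracket \<omega> A B z =
    (\<Sum>i\<in>UNIV. \<Sum>j\<in>UNIV. partial i A z * \<omega> z $ i $ j * partial j B z)"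

definition functionally_independent_on ::
    "(real ^ 'n) set \<Rightarrow> ('c::finite \<Rightarrow> real ^ 'n \<Rightarrow> real) \<Rightarrow> bool" where
  "functionally_independent_on U \<Phi> \<longleftrightarrow>
    (\<forall>z\<in>U. rank ((\<chi> \<alpha> i. partial i (\<Phi> \<alpha>) z) :: real ^ 'n ^ 'c) = CARD('c))"

definition constraint_surface ::
    "(real ^ 'n) set \<Rightarrow> ('c::finite \<Rightarrow> real ^ 'n \<Rightarrow> real) \<Rightarrow> (real ^ 'n) set" where
  "constraint_surface U \<Phi> = {z \<in> U. \<forall>\<alpha>. \<Phi> \<alpha> z = 0}"

definition constraint_matrix ::
    "'n tensor2 \<Rightarrow> ('c::finite \<Rightarrow> real ^ 'n \<Rightarrow> real) \<Rightarrow> real ^ 'n \<Rightarrow> real ^ 'c ^ 'c" where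
  "constraint_matrix \<omega> \<Phi> z = (\<chi> \<alpha> \<beta>. bracket \<omega> (\<Phi> \<alpha>) (\<Phi> \<beta>) z)"

text \<open>The largest set on which the inverse matrix in the Dirac tensor exists.\<close>

definition dirac_domain ::
    "(real ^ 'n) set \<Rightarrow> 'n tensor2 \<Rightarrow> ('c::finite \<Rightarrow> real ^ 'n \<Rightarrow> real) \<Rightarrow> (real ^ 'n) set" where
  "dirac_domain U \<omega> \<Phi> = {z \<in> U. det (constraint_matrix \<omega> \<Phi> z) \<noteq> 0}"

definition dirac_tensor ::
    "'n tensor2 \<Rightarrow> ('c::finite \<Rightarrow> real ^ 'n \<Rightarrow> real) \<Rightarrow> 'n tensor2" where
  "dirac_tensor \<omega> \<Phi> z = (\<chi> i j.
      bracket \<omega> (\<lambda>y. y $ i) (\<lambda>y. y $ j) z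
    - (\<Sum>\<alpha>\<in>UNIV. \<Sum>\<beta>\<in>UNIV.
         bracket \<omega> (\<lambda>y. y $ i) (\<Phi> \<alpha>) z
       * matrix_inv (constraint_matrix \<omega> \<Phi> z) $ \<alpha> $ \<beta>
       * bracket \<omega> (\<Phi> \<beta>) (\<lambda>y. y $ j) z))"

definition dirac_bracket ::
    "'n tensor2 \<Rightarrow> ('c::finite \<Rightarrow> real ^ 'n \<Rightarrow> real) \<Rightarrow>
      (real ^ 'n \<Rightarrow> real) \<Rightarrow> (real ^ 'n \<Rightarrow> real) \<Rightarrow> real ^ 'n \<Rightarrow> real" where
  "dirac_bracket \<omega> \<Phi> = bracket (dirac_tensor \<omega> \<Phi>)"

end

theory Submission
  imports Defs
begin

text \<open>
  Put \<open>u\<^sup>i\<^sub>\<beta> = {z\<^sup>i, \<Phi>\<^sup>\<alpha>} \<Delta>\<^sub>\<alpha>\<^sub>\<beta>\<close> (inverse matrix) and \<open>P\<^sup>i\<^sub>q = \<delta>\<^sup>i\<^sub>q - u\<^sup>i\<^sub>\<beta> \<partial>\<^sub>q\<Phi>\<^sup>\<beta>\<close>. Then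
  \<open>\<omega>\<^sub>D = P \<omega> = \<omega> P\<^sup>T = P \<omega> P\<^sup>T\<close>, and \<open>\<omega>\<^sub>D\<close> annihilates every \<open>d\<Phi>\<^sup>\<beta>\<close>. Differentiating \<open>P \<omega> P\<^sup>T\<close>
  gives three kinds of terms. Those with \<open>\<partial>\<omega>\<close> cancel cyclically by the Jacobi identity of \<open>\<omega>\<close>
  contracted with three copies of \<open>P\<close>; those with \<open>\<partial>u\<close> vanish because \<open>\<omega>\<^sub>D d\<Phi> = 0\<close>; those with the
  Hessian of \<open>\<Phi>\<^sup>\<beta>\<close> are products of \<open>u\<^sup>i\<^sub>\<beta>\<close> with a symmetric tensor and cancel cyclically in pairs.
  The Jacobi identity of the bracket follows from that of the tensor, the Hessians of the three
  functions cancelling in the same way.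
\<close>

subsection \<open>Partial derivatives\<close>

text \<open>The chain rule along a coordinate line. The parameter \<open>x\<close> is arbitrary, not
  just 0, because the mean value theorem needs the derivative all along a segment.\<close>

lemma partial_has_real_derivative:
  assumes "f differentiable (at (w + x *\<^sub>R axis i 1))"
  shows "((\<lambda>t. f (w + t *\<^sub>R axis i 1)) has_real_derivative partial i f (w + x *\<^sub>R axis i 1)) (at x)"
proof -
  let ?z = "w + x *\<^sub>R axis i (1::real)"
  obtain f' where f': "(f has_derivative f') (at ?z)"
    using assms by (auto simp: differentiable_def)
  have lin: "linear f'" using f' has_derivative_linear by blast
  \<comment> \<open>Used for two parametrizations through \<open>?z\<close>: base \<open>?z\<close>
    at parameter 0 identifies \<open>partial i f ?z\<close>, base \<open>w\<close> at parameter
    \<open>x\<close> gives the claim.\<close>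
  have line: "((\<lambda>t. f (v + t *\<^sub>R axis i 1)) has_real_derivative f' (axis i 1)) (at y)"
    if "v + y *\<^sub>R axis i 1 = ?z" for v and y :: real
  proof -
    have "((\<lambda>t. v + t *\<^sub>R axis i (1::real)) has_derivative (\<lambda>t. t *\<^sub>R axis i 1)) (at y)"
      by (auto intro!: derivative_eq_intros)
    from has_derivative_compose[OF this] f' that
    have "((\<lambda>t. f (v + t *\<^sub>R axis i 1)) has_derivative (\<lambda>t. f' (t *\<^sub>R axis i 1))) (at y)"
      by simp
    moreover have "f' (t *\<^sub>R axis i 1) = f' (axis i 1) * t" for t
      using linear_scale[OF lin] by simp
    ultimately show ?thesis
      by (simp add: has_field_derivative_def)
  qed
  have "partial i f ?z = f' (axis i 1)"
    unfolding partial_def by (rule DERIV_imp_deriv) (rule line, simp)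
  then show ?thesis using line[of w x] by simp
qed

lemma partial_eqI:
  assumes "((\<lambda>t. f (z + t *\<^sub>R axis i 1)) has_real_derivative D) (at 0)"
  shows "partial i f z = D"
  using assms unfolding partial_def by (rule DERIV_imp_deriv)

lemma partial_has_real_derivative_0:
  assumes "f differentiable (at z)"
  shows "((\<lambda>t. f (z + t *\<^sub>R axis i 1)) has_real_derivative partial i f z) (at 0)"
  using partial_has_real_derivative[of f z 0 i] assms by simp

lemma partial_component: "partial i (\<lambda>y. y $ j) z = (if i = j then 1 else 0)"
  by (rule partial_eqI) (auto simp: axis_def intro!: derivative_eq_intros)

lemma partial_const: "partial i (\<lambda>y. c) z = 0"
  by (rule partial_eqI) simp

lemma partial_diff:
  assumes "f differentiable (at z)" "g differentiable (at z)"
  shows "partial i (\<lambda>y. f y - g y) z = partial i f z - partial i g z"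
  by (rule partial_eqI) (intro DERIV_diff partial_has_real_derivative_0 assms)

lemma partial_mult:
  assumes "f differentiable (at z)" "g differentiable (at z)"
  shows "partial i (\<lambda>y. f y * g y) z = partial i f z * g z + f z * partial i g z"
  using DERIV_mult[OF partial_has_real_derivative_0[OF assms(1)] partial_has_real_derivative_0[OF assms(2)]]
  by (intro partial_eqI) (simp add: mult.commute)

lemma partial_sum:
  assumes "\<And>a. a \<in> S \<Longrightarrow> f a differentiable (at z)"
  shows "partial i (\<lambda>y. \<Sum>a\<in>S. f a y) z = (\<Sum>a\<in>S. partial i (f a) z)"
  by (rule partial_eqI) (intro DERIV_sum partial_has_real_derivative_0 assms)

text \<open>\<open>partial\<close> depends only on the germ of the function, so a formula valid just
  on an open set may be differentiated there. The sandwich form of the Dirac tensor is such a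
  formula.\<close>

lemma partial_cong_open:
  assumes "open V" "z \<in> V" "\<And>y. y \<in> V \<Longrightarrow> f y = g y"
  shows "partial i f z = partial i g z"
proof -
  have "open ((\<lambda>t. z + t *\<^sub>R axis i (1::real)) -` V)"
    by (rule open_vimage[OF assms(1)]) (intro continuous_intros)
  then have "eventually (\<lambda>t. t \<in> (\<lambda>t. z + t *\<^sub>R axis i (1::real)) -` V) (nhds 0)"
    by (rule eventually_nhds_in_open) (simp add: assms)
  then have "eventually (\<lambda>t. f (z + t *\<^sub>R axis i 1) = g (z + t *\<^sub>R axis i 1)) (nhds 0)"
    by eventually_elim (simp add: assms)
  then show ?thesis unfolding partial_def by (rule deriv_cong_ev) simp
qed

lemma smooth_on_partial: "smooth_on U f \<Longrightarrow> smooth_on U (partial i f)"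
  unfolding smooth_on_def by (metis Ck_on.simps(2))

lemma smooth_on_differentiable_at:
  assumes "smooth_on U f" "open U" "z \<in> U"
  shows "f differentiable (at z)"
proof -
  have "Ck_on (Suc 0) U f" using assms(1) unfolding smooth_on_def by blast
  then have "f differentiable_on U" by simp
  then show ?thesis using assms by (simp add: differentiable_on_eq_differentiable_at)
qed

lemma smooth_on_continuous_on: "smooth_on U f \<Longrightarrow> continuous_on U f"
  unfolding smooth_on_def by (metis Ck_on.simps(1))

section \<open>Symmetry of second partial derivatives\<close>

text \<open>The mean value theorem is applied twice: in direction \<open>i\<close> to the difference
  of \<open>f\<close> along two parallel edges of the square, then in direction \<open>j\<close> to
  \<open>partial i f\<close>. The second difference on the left is symmetric in \<open>i\<close> and
  \<open>j\<close>.\<close>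

lemma second_difference_mean_value:
  assumes f: "\<And>y. y \<in> U \<Longrightarrow> f differentiable (at y)"
    and fi: "\<And>y. y \<in> U \<Longrightarrow> partial i f differentiable (at y)"
    and s: "0 < s"
    and U: "\<And>x y. 0 \<le> x \<Longrightarrow> x \<le> s \<Longrightarrow> 0 \<le> y \<Longrightarrow> y \<le> s \<Longrightarrow> z + x *\<^sub>R axis i 1 + y *\<^sub>R axis j 1 \<in> U"
  shows "\<exists>x y. 0 < x \<and> x < s \<and> 0 < y \<and> y < s \<and>
    f (z + s *\<^sub>R axis i 1 + s *\<^sub>R axis j 1) - f (z + s *\<^sub>R axis i 1) - f (z + s *\<^sub>R axis j 1) + f z
      = s * s * partial j (partial i f) (z + x *\<^sub>R axis i 1 + y *\<^sub>R axis j 1)"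
proof -
  have der: "((\<lambda>x. f (z + x *\<^sub>R axis i 1 + y *\<^sub>R axis j 1)) has_real_derivative
      partial i f (z + x *\<^sub>R axis i 1 + y *\<^sub>R axis j 1)) (at x)"
    if "0 \<le> x" "x \<le> s" "0 \<le> y" "y \<le> s" for x y
    using partial_has_real_derivative[of f "z + y *\<^sub>R axis j 1" x i] f[OF U[OF that]]
    by (simp add: algebra_simps)
  have "\<exists>x. 0 < x \<and> x < s \<and>
      (f (z + s *\<^sub>R axis i 1 + s *\<^sub>R axis j 1) - f (z + s *\<^sub>R axis i 1 + 0 *\<^sub>R axis j 1))
      - (f (z + 0 *\<^sub>R axis i 1 + s *\<^sub>R axis j 1) - f (z + 0 *\<^sub>R axis i 1 + 0 *\<^sub>R axis j 1))
      = (s - 0) * (partial i f (z + x *\<^sub>R axis i 1 + s *\<^sub>R axis j 1)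
          - partial i f (z + x *\<^sub>R axis i 1 + 0 *\<^sub>R axis j 1))"
    using s by (intro MVT2 DERIV_diff der) auto
  then obtain x where x: "0 < x" "x < s" and
    1: "f (z + s *\<^sub>R axis i 1 + s *\<^sub>R axis j 1) - f (z + s *\<^sub>R axis i 1) - f (z + s *\<^sub>R axis j 1) + f z
      = s * (partial i f (z + x *\<^sub>R axis i 1 + s *\<^sub>R axis j 1) - partial i f (z + x *\<^sub>R axis i 1))"
    by auto
  have "\<exists>y. 0 < y \<and> y < s \<and>
      partial i f (z + x *\<^sub>R axis i 1 + s *\<^sub>R axis j 1)
        - partial i f (z + x *\<^sub>R axis i 1 + 0 *\<^sub>R axis j 1)
      = (s - 0) * partial j (partial i f) (z + x *\<^sub>R axis i 1 + y *\<^sub>R axis j 1)"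
    using s x by (intro MVT2 partial_has_real_derivative fi U) auto
  then obtain y where "0 < y" "y < s" and
    "partial i f (z + x *\<^sub>R axis i 1 + s *\<^sub>R axis j 1) - partial i f (z + x *\<^sub>R axis i 1)
      = s * partial j (partial i f) (z + x *\<^sub>R axis i 1 + y *\<^sub>R axis j 1)"
    by auto
  with x 1 show ?thesis by (intro exI[of _ x] exI[of _ y]) auto
qed

text \<open>Each mixed derivative attains the same quotient, the second difference over
  \<open>s * s\<close>, at some point near \<open>z\<close>. Continuity of both then leaves no room
  for a gap at \<open>z\<close>.\<close>

lemma partial_partial_commute:
  assumes f: "smooth_on U f" and U: "open U" "z \<in> U"
  shows "partial i (partial j f) z = partial j (partial i f) z"
proof (rule ccontr)
  let ?g = "partial j (partial i f)" and ?h = "partial i (partial j f)"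
  assume "?h z \<noteq> ?g z"
  \<comment> \<open>Half the gap: two errors below \<open>e\<close> add up to less than the
    gap.\<close>
  define e where "e = \<bar>?h z - ?g z\<bar> / 2"
  have e: "e > 0" using \<open>?h z \<noteq> ?g z\<close> by (simp add: e_def)
  have "isCont ?g z" "isCont ?h z"
    using f U by (metis smooth_on_partial smooth_on_continuous_on continuous_on_eq_continuous_at)+
  then obtain d1 d2 where d: "d1 > 0" "d2 > 0"
    and d1: "\<And>y. dist y z < d1 \<Longrightarrow> dist (?g y) (?g z) < e"
    and d2: "\<And>y. dist y z < d2 \<Longrightarrow> dist (?h y) (?h z) < e"
    using e unfolding continuous_at_eps_delta by (metis dist_commute)
  obtain d3 where d3: "d3 > 0" "ball z d3 \<subseteq> U" using U open_contains_ball by blast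
  \<comment> \<open>The points of the square have distance at most \<open>2 * s\<close> from
    \<open>z\<close>; dividing by 3 keeps this strictly below all three radii.\<close>
  define s where "s = min d1 (min d2 d3) / 3"
  have s: "s > 0" using d d3 by (simp add: s_def)
  have near: "dist (z + x *\<^sub>R axis a 1 + y *\<^sub>R axis b 1) z < min d1 (min d2 d3)"
    if "0 \<le> x" "x \<le> s" "0 \<le> y" "y \<le> s" for x y a b
  proof -
    have "dist (z + x *\<^sub>R axis a 1 + y *\<^sub>R axis b 1) z = norm (x *\<^sub>R axis a (1::real) + y *\<^sub>R axis b 1)"
      by (simp add: dist_norm)
    also have "\<dots> \<le> x + y"
      using norm_triangle_ineq[of "x *\<^sub>R axis a (1::real)" "y *\<^sub>R axis b 1"] that by (simp add: norm_axis_1)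
    also have "\<dots> < 3 * s" using that s by simp
    finally show ?thesis by (simp add: s_def)
  qed
  have nearU: "z + x *\<^sub>R axis a 1 + y *\<^sub>R axis b 1 \<in> U"
    if "0 \<le> x" "x \<le> s" "0 \<le> y" "y \<le> s" for x y a b
    using near[OF that, of a b] d3 by (auto simp: dist_commute)
  have second_difference: "\<exists>x y. 0 < x \<and> x < s \<and> 0 < y \<and> y < s \<and>
    f (z + s *\<^sub>R axis a 1 + s *\<^sub>R axis b 1) - f (z + s *\<^sub>R axis a 1) - f (z + s *\<^sub>R axis b 1) + f z
      = s * s * partial b (partial a f) (z + x *\<^sub>R axis a 1 + y *\<^sub>R axis b 1)" for a b
    by (rule second_difference_mean_value[where U = U])
      (use s nearU smooth_on_differentiable_at[OF _ U(1)] smooth_on_partial f in blast)+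
  obtain x y where xy: "0 < x" "x < s" "0 < y" "y < s"
    "f (z + s *\<^sub>R axis i 1 + s *\<^sub>R axis j 1) - f (z + s *\<^sub>R axis i 1) - f (z + s *\<^sub>R axis j 1) + f z
      = s * s * ?g (z + x *\<^sub>R axis i 1 + y *\<^sub>R axis j 1)"
    using second_difference[of i j] by blast
  obtain x' y' where xy': "0 < x'" "x' < s" "0 < y'" "y' < s"
    "f (z + s *\<^sub>R axis j 1 + s *\<^sub>R axis i 1) - f (z + s *\<^sub>R axis j 1) - f (z + s *\<^sub>R axis i 1) + f z
      = s * s * ?h (z + x' *\<^sub>R axis j 1 + y' *\<^sub>R axis i 1)"
    using second_difference[of j i] by blast
  have swap: "z + s *\<^sub>R axis j 1 + s *\<^sub>R axis i 1 = z + s *\<^sub>R axis i 1 + s *\<^sub>R axis j 1"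
    by simp
  have "s * s * ?g (z + x *\<^sub>R axis i 1 + y *\<^sub>R axis j 1) = s * s * ?h (z + x' *\<^sub>R axis j 1 + y' *\<^sub>R axis i 1)"
    using xy(5) xy'(5) unfolding swap by linarith
  then have "?g (z + x *\<^sub>R axis i 1 + y *\<^sub>R axis j 1) = ?h (z + x' *\<^sub>R axis j 1 + y' *\<^sub>R axis i 1)"
    using s by simp
  moreover have "dist (?g (z + x *\<^sub>R axis i 1 + y *\<^sub>R axis j 1)) (?g z) < e"
    using near[of x y i j] xy by (intro d1) auto
  moreover have "dist (?h (z + x' *\<^sub>R axis j 1 + y' *\<^sub>R axis i 1)) (?h z) < e"
    using near[of x' y' j i] xy' by (intro d2) auto
  ultimately have "dist (?g z) (?h z) < \<bar>?h z - ?g z\<bar>"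
    unfolding e_def by (metis dist_triangle_half_r)
  then show False by (simp add: dist_real_def)
qed

subsection \<open>Cyclic cancellations\<close>

lemma sum_swap3:
  fixes f :: "'a \<Rightarrow> 'b \<Rightarrow> 'c \<Rightarrow> real"
  shows "(\<Sum>p\<in>A. \<Sum>a\<in>B. \<Sum>b\<in>C. f p a b) = (\<Sum>a\<in>B. \<Sum>b\<in>C. \<Sum>p\<in>A. f p a b)"
  by (subst sum.swap) (rule sum.cong[OF refl], rule sum.swap)

text \<open>Renaming summation indices moves the cyclic permutation from the vectors
  \<open>X\<close>, \<open>Y\<close>, \<open>Z\<close> to the indices of \<open>J\<close>. The
  vectors will be rows of \<open>P\<close> or gradients of functions.\<close>

lemma cyclic_contraction_eq_0:
  fixes J :: "'n::finite \<Rightarrow> 'n \<Rightarrow> 'n \<Rightarrow> real"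
  assumes "\<And>a b c. J a b c + J b c a + J c a b = 0"
  shows "(\<Sum>a\<in>UNIV. \<Sum>b\<in>UNIV. \<Sum>c\<in>UNIV. X a * Y b * Z c * J a b c)
    + (\<Sum>a\<in>UNIV. \<Sum>b\<in>UNIV. \<Sum>c\<in>UNIV. Y a * Z b * X c * J a b c)
    + (\<Sum>a\<in>UNIV. \<Sum>b\<in>UNIV. \<Sum>c\<in>UNIV. Z a * X b * Y c * J a b c) = 0"
proof -
  have 1: "(\<Sum>a\<in>UNIV. \<Sum>b\<in>UNIV. \<Sum>c\<in>UNIV. Y a * Z b * X c * J a b c)
      = (\<Sum>a\<in>UNIV. \<Sum>b\<in>UNIV. \<Sum>c\<in>UNIV. X a * Y b * Z c * J b c a)"
    by (subst sum_swap3[symmetric]) (simp add: mult_ac)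
  have 2: "(\<Sum>a\<in>UNIV. \<Sum>b\<in>UNIV. \<Sum>c\<in>UNIV. Z a * X b * Y c * J a b c)
      = (\<Sum>a\<in>UNIV. \<Sum>b\<in>UNIV. \<Sum>c\<in>UNIV. X a * Y b * Z c * J c a b)"
    by (subst sum_swap3) (simp add: mult_ac)
  show ?thesis
    unfolding 1 2 sum.distrib[symmetric] distrib_left[symmetric] assms by simp
qed

text \<open>The computation at a single point, with derivatives treated as independent arrays:
  \<open>v\<close> and \<open>h\<close> stand for gradients and Hessians of the constraints,
  \<open>w\<close> for the Poisson tensor, and \<open>dP\<close>, \<open>du\<close>,
  \<open>dw\<close>, \<open>dT\<close> for first derivatives. Hypothesis \<open>dT\<close> is the
  product rule for the sandwich of \<open>w\<close> between two copies of \<open>P\<close>.\<close>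

lemma projected_tensor_jacobi:
  fixes w T :: "'n::finite \<Rightarrow> 'n \<Rightarrow> real" and P :: "'n \<Rightarrow> 'n \<Rightarrow> real"
    and u :: "'n \<Rightarrow> 'c::finite \<Rightarrow> real" and v :: "'c \<Rightarrow> 'n \<Rightarrow> real"
    and h :: "'c \<Rightarrow> 'n \<Rightarrow> 'n \<Rightarrow> real"
  assumes T_left: "\<And>i j. T i j = (\<Sum>a\<in>UNIV. P i a * w a j)"
    and T_right: "\<And>i j. T i j = (\<Sum>b\<in>UNIV. w i b * P j b)"
    and T_anti: "\<And>i j. T i j = - T j i"
    and Tv: "\<And>i \<beta>. (\<Sum>a\<in>UNIV. T i a * v \<beta> a) = 0"
    and h_sym: "\<And>\<beta> a b. h \<beta> a b = h \<beta> b a"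
    and dP: "\<And>p i a. dP p i a = - (\<Sum>\<beta>\<in>UNIV. du p i \<beta> * v \<beta> a + u i \<beta> * h \<beta> p a)"
    and dT: "\<And>p i j. dT p i j = (\<Sum>a\<in>UNIV. \<Sum>b\<in>UNIV.
        dP p i a * w a b * P j b + P i a * dw p a b * P j b + P i a * w a b * dP p j b)"
    and jacobi: "\<And>i j k. (\<Sum>p\<in>UNIV. w i p * dw p j k) + (\<Sum>p\<in>UNIV. w j p * dw p k i)
        + (\<Sum>p\<in>UNIV. w k p * dw p i j) = 0"
  shows "(\<Sum>p\<in>UNIV. T i p * dT p j k) + (\<Sum>p\<in>UNIV. T j p * dT p k i)
        + (\<Sum>p\<in>UNIV. T k p * dT p i j) = 0"
proof -
  \<comment> \<open>\<open>S\<close> is the symmetric Hessian contribution, \<open>E\<close> the one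
    from derivatives of \<open>w\<close>. \<open>K\<close> is the derivative of \<open>P\<close>
    contracted with \<open>T\<close>, so by \<open>Tv\<close> its \<open>du\<close> part drops
    out.\<close>
  define S where "S \<beta> i k = (\<Sum>p\<in>UNIV. \<Sum>a\<in>UNIV. T i p * h \<beta> p a * T k a)" for \<beta> i k
  define J where "J q a b = (\<Sum>p\<in>UNIV. w q p * dw p a b)" for q a b
  define E where "E i j k = (\<Sum>q\<in>UNIV. \<Sum>a\<in>UNIV. \<Sum>b\<in>UNIV. P i q * P j a * P k b * J q a b)" for i j k
  define K where "K p j k = (\<Sum>a\<in>UNIV. dP p j a * T k a)" for p j k
  have S_sym: "S \<beta> i k = S \<beta> k i" for \<beta> i k
    unfolding S_def by (subst sum.swap) (simp add: h_sym[of \<beta>] mult_ac)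
  have K_eq: "K p j k = - (\<Sum>\<beta>\<in>UNIV. u j \<beta> * (\<Sum>a\<in>UNIV. h \<beta> p a * T k a))" for p j k
  proof -
    have "K p j k = - (\<Sum>a\<in>UNIV. \<Sum>\<beta>\<in>UNIV. du p j \<beta> * (T k a * v \<beta> a) + u j \<beta> * (h \<beta> p a * T k a))"
      unfolding K_def dP by (simp add: sum_negf[symmetric] sum_distrib_right sum_distrib_left algebra_simps)
    also have "\<dots> = - (\<Sum>\<beta>\<in>UNIV. du p j \<beta> * (\<Sum>a\<in>UNIV. T k a * v \<beta> a) + u j \<beta> * (\<Sum>a\<in>UNIV. h \<beta> p a * T k a))"
      by (subst sum.swap) (simp add: sum.distrib sum_distrib_left)
    finally show ?thesis by (simp add: Tv)
  qed
  have TK: "(\<Sum>p\<in>UNIV. T i p * K p j k) = - (\<Sum>\<beta>\<in>UNIV. u j \<beta> * S \<beta> i k)" for i j k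
    unfolding K_eq S_def sum_distrib_left sum_negf[symmetric]
    by (subst sum.swap) (simp add: sum_distrib_left mult_ac sum_negf)
  \<comment> \<open>In the first product-rule term \<open>w\<close> and the right factor
    \<open>P\<close> combine to \<open>T a k\<close>, in the last the left factor and
    \<open>w\<close> combine to \<open>T j b\<close>. Turning \<open>T a k\<close> into
    \<open>- T k a\<close> causes the opposite signs.\<close>
  have dT_eq: "dT p j k = - K p j k + (\<Sum>a\<in>UNIV. \<Sum>b\<in>UNIV. P j a * dw p a b * P k b) + K p k j" for p j k
  proof -
    have 1: "(\<Sum>a\<in>UNIV. \<Sum>b\<in>UNIV. dP p j a * w a b * P k b) = - K p j k"
    proof -
      have "(\<Sum>a\<in>UNIV. \<Sum>b\<in>UNIV. dP p j a * w a b * P k b) = (\<Sum>a\<in>UNIV. dP p j a * T a k)"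
        unfolding T_right by (simp add: sum_distrib_left mult.assoc)
      also have "\<dots> = - K p j k"
        unfolding K_def T_anti[of _ k] by (simp add: sum_negf)
      finally show ?thesis .
    qed
    have 2: "(\<Sum>a\<in>UNIV. \<Sum>b\<in>UNIV. P j a * w a b * dP p k b) = K p k j"
      unfolding K_def T_left
      by (subst sum.swap) (simp add: sum_distrib_left mult_ac)
    show ?thesis unfolding dT sum.distrib 1 2 ..
  qed
  \<comment> \<open>Writing \<open>T i p\<close> as \<open>P\<close> times \<open>w\<close> supplies
    the third copy of \<open>P\<close> and the factor \<open>w q p\<close> that completes
    \<open>J\<close>.\<close>
  have mid: "(\<Sum>p\<in>UNIV. T i p * (\<Sum>a\<in>UNIV. \<Sum>b\<in>UNIV. P j a * dw p a b * P k b)) = E i j k" for i j k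
  proof -
    have "(\<Sum>p\<in>UNIV. T i p * (\<Sum>a\<in>UNIV. \<Sum>b\<in>UNIV. P j a * dw p a b * P k b))
      = (\<Sum>p\<in>UNIV. \<Sum>q\<in>UNIV. \<Sum>a\<in>UNIV. \<Sum>b\<in>UNIV. P i q * P j a * P k b * (w q p * dw p a b))"
      unfolding T_left sum_distrib_right by (simp add: sum_distrib_left mult_ac)
    also have "\<dots> = (\<Sum>q\<in>UNIV. \<Sum>p\<in>UNIV. \<Sum>a\<in>UNIV. \<Sum>b\<in>UNIV. P i q * P j a * P k b * (w q p * dw p a b))"
      by (rule sum.swap)
    also have "\<dots> = E i j k"
      unfolding E_def J_def sum_distrib_left
      by (rule sum.cong[OF refl], rule sum_swap3)
    finally show ?thesis .
  qed
  have main: "(\<Sum>p\<in>UNIV. T i p * dT p j k)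
      = (\<Sum>\<beta>\<in>UNIV. u j \<beta> * S \<beta> i k) + E i j k - (\<Sum>\<beta>\<in>UNIV. u k \<beta> * S \<beta> i j)" for i j k
    unfolding dT_eq distrib_left sum.distrib mid by (simp add: sum_negf TK)
  have "E i j k + E j k i + E k i j = 0"
    unfolding E_def by (rule cyclic_contraction_eq_0) (simp add: J_def jacobi)
  \<comment> \<open>In the cyclic sum each product of \<open>u\<close> and \<open>S\<close> occurs
    twice with opposite signs, up to the symmetry of \<open>S\<close>.\<close>
  then show ?thesis
    unfolding main S_sym[of _ k j] S_sym[of _ j i] S_sym[of _ k i] by simp
qed

text \<open>Again pointwise algebra: \<open>a\<close>, \<open>b\<close>, \<open>c\<close> are
  gradients, \<open>ha\<close>, \<open>hb\<close>, \<open>hc\<close> Hessians, and \<open>F\<close>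
  is the iterated bracket after the product rule. Each Hessian enters two of the three brackets,
  with opposite signs and the same two vectors.\<close>

lemma bracket_jacobi_cyclic:
  fixes T :: "'n::finite \<Rightarrow> 'n \<Rightarrow> real" and a b c :: "'n \<Rightarrow> real" and ha hb hc :: "'n \<Rightarrow> 'n \<Rightarrow> real"
  assumes T_anti: "\<And>i j. T i j = - T j i"
    and sym: "\<And>p q. ha p q = ha q p" "\<And>p q. hb p q = hb q p" "\<And>p q. hc p q = hc q p"
    and jacobi: "\<And>i j k. (\<Sum>p\<in>UNIV. T i p * dT p j k) + (\<Sum>p\<in>UNIV. T j p * dT p k i)
        + (\<Sum>p\<in>UNIV. T k p * dT p i j) = 0"
  defines "F \<equiv> \<lambda>a b c hb hc. \<Sum>i\<in>UNIV. \<Sum>p\<in>UNIV. a i * T i p *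
      (\<Sum>j\<in>UNIV. \<Sum>k\<in>UNIV. hb p j * T j k * c k + b j * dT p j k * c k + b j * T j k * hc p k)"
  shows "F a b c hb hc + F b c a hc ha + F c a b ha hb = 0"
proof -
  \<comment> \<open>\<open>X\<close> is the Hamiltonian vector of a gradient up to sign,
    \<open>Q\<close> the bilinear form of a Hessian, \<open>M\<close> the part without second
    derivatives.\<close>
  define X where "X a p = (\<Sum>i\<in>UNIV. a i * T i p)" for a :: "'n \<Rightarrow> real" and p
  define Q where "Q h x y = (\<Sum>p\<in>UNIV. \<Sum>q\<in>UNIV. x p * h p q * y q)" for h :: "'n \<Rightarrow> 'n \<Rightarrow> real" and x y
  define J where "J i j k = (\<Sum>p\<in>UNIV. T i p * dT p j k)" for i j k
  define M where "M a b c = (\<Sum>i\<in>UNIV. \<Sum>j\<in>UNIV. \<Sum>k\<in>UNIV. a i * b j * c k * J i j k)" for a b c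
  have Q_sym: "Q h x y = Q h y x" if "\<And>p q. h p q = h q p" for h x y
    unfolding Q_def by (subst sum.swap) (simp add: that mult_ac)
  have F_eq: "F a b c hb hc = - Q hb (X a) (X c) + M a b c + Q hc (X a) (X b)" for a b c hb hc
  proof -
    \<comment> \<open>Here \<open>c\<close> meets the second index of \<open>T\<close>, in
      \<open>2\<close> below \<open>b\<close> meets the first; this produces the relative
      sign.\<close>
    have 1: "(\<Sum>j\<in>UNIV. \<Sum>k\<in>UNIV. hb p j * T j k * c k) = - (\<Sum>j\<in>UNIV. hb p j * X c j)" for p
    proof -
      have "(\<Sum>k\<in>UNIV. T j k * c k) = - X c j" for j
        unfolding X_def T_anti[of j] by (simp add: sum_negf mult.commute)
      moreover have "(\<Sum>j\<in>UNIV. \<Sum>k\<in>UNIV. hb p j * T j k * c k)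
          = (\<Sum>j\<in>UNIV. hb p j * (\<Sum>k\<in>UNIV. T j k * c k))"
        by (simp add: sum_distrib_left mult.assoc)
      ultimately show ?thesis by (simp add: sum_negf)
    qed
    have 2: "(\<Sum>j\<in>UNIV. \<Sum>k\<in>UNIV. b j * T j k * hc p k) = (\<Sum>k\<in>UNIV. hc p k * X b k)" for p
      unfolding X_def by (subst sum.swap) (simp add: sum_distrib_left mult_ac)
    have 3: "(\<Sum>p\<in>UNIV. X a p * (\<Sum>j\<in>UNIV. \<Sum>k\<in>UNIV. b j * dT p j k * c k)) = M a b c"
    proof -
      have "(\<Sum>p\<in>UNIV. X a p * (\<Sum>j\<in>UNIV. \<Sum>k\<in>UNIV. b j * dT p j k * c k))
        = (\<Sum>p\<in>UNIV. \<Sum>i\<in>UNIV. \<Sum>j\<in>UNIV. \<Sum>k\<in>UNIV. a i * b j * c k * (T i p * dT p j k))"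
        unfolding X_def sum_distrib_right by (simp add: sum_distrib_left mult_ac)
      also have "\<dots> = (\<Sum>i\<in>UNIV. \<Sum>p\<in>UNIV. \<Sum>j\<in>UNIV. \<Sum>k\<in>UNIV. a i * b j * c k * (T i p * dT p j k))"
        by (rule sum.swap)
      also have "\<dots> = M a b c"
        unfolding M_def J_def sum_distrib_left by (rule sum.cong[OF refl], rule sum_swap3)
      finally show ?thesis .
    qed
    have 4: "(\<Sum>p\<in>UNIV. x p * (\<Sum>q\<in>UNIV. h p q * y q)) = Q h x y" for x h y
      unfolding Q_def by (simp add: sum_distrib_left mult.assoc)
    have "F a b c hb hc = (\<Sum>p\<in>UNIV. X a p *
      (\<Sum>j\<in>UNIV. \<Sum>k\<in>UNIV. hb p j * T j k * c k + b j * dT p j k * c k + b j * T j k * hc p k))"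
      unfolding F_def X_def by (subst sum.swap) (simp only: sum_distrib_right)
    then show ?thesis
      unfolding sum.distrib 1 2 distrib_left 3 by (simp add: 4 sum_negf)
  qed
  have "M a b c + M b c a + M c a b = 0"
    unfolding M_def by (rule cyclic_contraction_eq_0) (simp add: J_def jacobi)
  then show ?thesis
    unfolding F_eq using Q_sym[of ha "X b" "X c"] Q_sym[of hb "X a" "X c"] Q_sym[of hc "X a" "X b"] sym
    by simp
qed

text \<open>The tensor enters through its value and first derivatives at \<open>z\<close>. The
  neighbourhood \<open>W\<close> carries the smoothness of the functions, which makes their Hessians
  symmetric.\<close>

lemma bracket_jacobi:
  assumes W: "open W" "z \<in> W"
    and anti: "\<And>i j. T z $ i $ j = - T z $ j $ i"
    and diff: "\<And>i j. (\<lambda>y. T y $ i $ j) differentiable (at z)"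
    and jacobi: "jacobi_tensor_at T z"
    and smooth: "smooth_on W A" "smooth_on W B" "smooth_on W C"
  shows "bracket T A (bracket T B C) z + bracket T B (bracket T C A) z + bracket T C (bracket T A B) z = 0"
proof -
  let ?h = "\<lambda>F p j. partial p (partial j F) z"
  have partial_bracket: "partial p (bracket T F G) z = (\<Sum>j\<in>UNIV. \<Sum>k\<in>UNIV.
      ?h F p j * T z $ j $ k * partial k G z
      + partial j F z * partial p (\<lambda>y. T y $ j $ k) z * partial k G z
      + partial j F z * T z $ j $ k * ?h G p k)"
    if "smooth_on W F" "smooth_on W G" for F G p
  proof -
    note d = diff smooth_on_differentiable_at[OF smooth_on_partial[OF that(1)] W]
      smooth_on_differentiable_at[OF smooth_on_partial[OF that(2)] W]
    have "partial p (bracket T F G) z =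
        partial p (\<lambda>y. \<Sum>j\<in>UNIV. \<Sum>k\<in>UNIV. partial j F y * T y $ j $ k * partial k G y) z"
      unfolding bracket_def ..
    then show ?thesis
      by (simp add: partial_sum partial_mult d distrib_right)
  qed
  show ?thesis
    unfolding bracket_def[of T _ "bracket _ _ _"] partial_bracket[OF smooth(1,2)]
      partial_bracket[OF smooth(2,3)] partial_bracket[OF smooth(3,1)]
  proof (rule bracket_jacobi_cyclic[where T = "\<lambda>i j. T z $ i $ j"
        and dT = "\<lambda>p j k. partial p (\<lambda>y. T y $ j $ k) z"
        and a = "\<lambda>i. partial i A z" and b = "\<lambda>i. partial i B z" and c = "\<lambda>i. partial i C z"
        and ha = "?h A" and hb = "?h B" and hc = "?h C"])
    show "T z $ i $ j = - T z $ j $ i" for i j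
      by (rule anti)
    show "?h A p q = ?h A q p" "?h B p q = ?h B q p" "?h C p q = ?h C q p" for p q
      using smooth W by (auto intro: partial_partial_commute)
    show "(\<Sum>p\<in>UNIV. T z $ i $ p * partial p (\<lambda>y. T y $ j $ k) z)
      + (\<Sum>p\<in>UNIV. T z $ j $ p * partial p (\<lambda>y. T y $ k $ i) z)
      + (\<Sum>p\<in>UNIV. T z $ k $ p * partial p (\<lambda>y. T y $ i $ j) z) = 0" for i j k
      using jacobi unfolding jacobi_tensor_at_def by blast
  qed
qed

subsection \<open>The Dirac tensor\<close>

lemma differentiable_prod:
  fixes f :: "'i \<Rightarrow> 'a::real_normed_vector \<Rightarrow> real"
  assumes "\<And>i. i \<in> I \<Longrightarrow> f i differentiable (at z)"
  shows "(\<lambda>y. \<Prod>i\<in>I. f i y) differentiable (at z)"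
  using assms by (induction I rule: infinite_finite_induct) auto

lemma differentiable_det:
  fixes A :: "'a::real_normed_vector \<Rightarrow> real ^ 'm ^ 'm"
  assumes "\<And>i j. (\<lambda>y. A y $ i $ j) differentiable (at z)"
  shows "(\<lambda>y. det (A y)) differentiable (at z)"
  unfolding det_def
  by (intro differentiable_sum differentiable_mult differentiable_const differentiable_prod ballI assms)
    (simp add: finite_permutations)

lemma matrix_inv_cancel:
  assumes "invertible A"
  shows "A ** matrix_inv A = mat 1" "matrix_inv A ** A = mat 1"
proof -
  have "A ** matrix_inv A = mat 1 \<and> matrix_inv A ** A = mat 1"
    using assms unfolding invertible_def matrix_inv_def by (rule someI_ex)
  then show "A ** matrix_inv A = mat 1" "matrix_inv A ** A = mat 1" by auto
qed

text \<open>Cramer's rule for the equation whose solution is column \<open>j\<close> of the inverse.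
  As a quotient of determinants, the entry is visibly differentiable in the entries of
  \<open>A\<close>.\<close>

lemma matrix_inv_component:
  fixes A :: "real ^ 'm ^ 'm"
  assumes "det A \<noteq> 0"
  shows "matrix_inv A $ i $ j = det (\<chi> a b. if b = i then axis j 1 $ a else A $ a $ b) / det A"
proof -
  have "invertible A" using assms by (simp add: invertible_det_nz)
  then have "A *v (matrix_inv A *v axis j 1) = axis j 1"
    by (simp add: matrix_vector_mul_assoc matrix_inv_cancel(1))
  then have "matrix_inv A *v axis j 1
      = (\<chi> i. det (\<chi> a b. if b = i then axis j 1 $ a else A $ a $ b) / det A)"
    using cramer[OF assms] by blast
  then show ?thesis
    by (simp add: matrix_vector_mul_component vec_eq_iff matrix_vector_mult_basis column_def)
qed

text \<open>Transposing \<open>matrix_inv A ** A = mat 1\<close> and using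
  \<open>transpose A = - A\<close> shows that \<open>- transpose (matrix_inv A)\<close> is a right
  inverse of \<open>A\<close>, hence the inverse.\<close>

lemma matrix_inv_antisymmetric:
  fixes A :: "real ^ 'm ^ 'm"
  assumes "invertible A" and anti: "\<And>i j. A $ i $ j = - A $ j $ i"
  shows "matrix_inv A $ i $ j = - matrix_inv A $ j $ i"
proof -
  let ?C = "matrix_inv A"
  have "transpose A ** transpose ?C = mat 1"
    using assms(1) by (metis matrix_transpose_mul matrix_inv_cancel(2) transpose_mat)
  moreover have "transpose A = - A"
    by (simp add: vec_eq_iff transpose_def anti[symmetric])
  then have "transpose A ** transpose ?C = A ** - transpose ?C"
    by (simp add: vec_eq_iff matrix_matrix_mult_def)
  ultimately have "?C ** (A ** - transpose ?C) = ?C" by simp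
  then have "- transpose ?C = ?C"
    using assms(1) by (simp only: matrix_mul_assoc matrix_inv_cancel(2) matrix_mul_lid)
  then have "(- transpose ?C) $ i $ j = ?C $ i $ j" by simp
  then show ?thesis by (simp add: transpose_def)
qed

section \<open>Brackets with coordinate functions\<close>

lemma bracket_component_left: "bracket \<omega> (\<lambda>y. y $ i) G z = (\<Sum>j\<in>UNIV. \<omega> z $ i $ j * partial j G z)"
proof -
  have "bracket \<omega> (\<lambda>y. y $ i) G z
      = (\<Sum>a\<in>UNIV. if i = a then \<Sum>j\<in>UNIV. \<omega> z $ a $ j * partial j G z else 0)"
    unfolding bracket_def by (intro sum.cong) (auto simp: partial_component)
  then show ?thesis by simp
qed

lemma bracket_component_right: "bracket \<omega> F (\<lambda>y. y $ j) z = (\<Sum>i\<in>UNIV. partial i F z * \<omega> z $ i $ j)"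
proof -
  have "bracket \<omega> F (\<lambda>y. y $ j) z
      = (\<Sum>i\<in>UNIV. \<Sum>b\<in>UNIV. if j = b then partial i F z * \<omega> z $ i $ b else 0)"
    unfolding bracket_def by (intro sum.cong) (auto simp: partial_component)
  then show ?thesis by simp
qed

section \<open>Algebra and derivatives of the Dirac tensor in one chart\<close>

context
  fixes U :: "(real ^ 'n) set" and \<omega> :: "'n tensor2" and \<Phi> :: "'c::finite \<Rightarrow> real ^ 'n \<Rightarrow> real"
  assumes openU: "open U" and poisson: "poisson_tensor_on U \<omega>"
    and smooth_\<Phi>: "\<And>\<alpha>. smooth_on U (\<Phi> \<alpha>)"
begin

private abbreviation (input) "D \<equiv> dirac_domain U \<omega> \<Phi>"
private abbreviation (input) "M \<equiv> constraint_matrix \<omega> \<Phi>"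
private abbreviation (input) "T \<equiv> dirac_tensor \<omega> \<Phi>"

private lemma \<omega>_anti: "z \<in> U \<Longrightarrow> \<omega> z $ i $ j = - \<omega> z $ j $ i"
  using poisson unfolding poisson_tensor_on_def by blast

private lemma differentiable_\<omega>: "z \<in> U \<Longrightarrow> (\<lambda>y. \<omega> y $ i $ j) differentiable (at z)"
  using poisson smooth_on_differentiable_at openU unfolding poisson_tensor_on_def by blast

private lemma differentiable_\<Phi>: "z \<in> U \<Longrightarrow> partial i (\<Phi> \<alpha>) differentiable (at z)"
  using smooth_on_differentiable_at[OF smooth_on_partial[OF smooth_\<Phi>] openU] .

private lemma differentiable_constraint_matrix:
  "z \<in> U \<Longrightarrow> (\<lambda>y. M y $ \<alpha> $ \<beta>) differentiable (at z)"
  unfolding constraint_matrix_def bracket_def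
  by (simp add: differentiable_\<omega> differentiable_\<Phi>)

text \<open>Preimage of the nonzero reals under the continuous determinant. Openness is what allows
  identities on this set to be differentiated.\<close>

lemma open_dirac_domain: "open (dirac_domain U \<omega> \<Phi>)"
proof -
  have "continuous_on U (\<lambda>z. det (M z))"
    by (intro differentiable_imp_continuous_on differentiable_at_imp_differentiable_on
        differentiable_det differentiable_constraint_matrix)
  then have "open (U \<inter> (\<lambda>z. det (M z)) -` (- {0}))"
    by (rule continuous_open_preimage[OF _ openU]) auto
  moreover have "U \<inter> (\<lambda>z. det (M z)) -` (- {0}) = D"
    unfolding dirac_domain_def by auto
  ultimately show ?thesis by simp
qed

private lemma dirac_domainD: "z \<in> D \<Longrightarrow> z \<in> U" "z \<in> D \<Longrightarrow> invertible (M z)"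
  unfolding dirac_domain_def by (auto simp: invertible_det_nz)

private lemma constraint_matrix_anti:
  assumes "z \<in> U"
  shows "M z $ \<alpha> $ \<beta> = - M z $ \<beta> $ \<alpha>"
proof -
  have "M z $ \<alpha> $ \<beta> = (\<Sum>j\<in>UNIV. \<Sum>i\<in>UNIV. partial i (\<Phi> \<alpha>) z * \<omega> z $ i $ j * partial j (\<Phi> \<beta>) z)"
    unfolding constraint_matrix_def bracket_def by (subst sum.swap) simp
  also have "\<dots> = - M z $ \<beta> $ \<alpha>"
    unfolding constraint_matrix_def bracket_def vec_lambda_beta sum_negf[symmetric]
    by (intro sum.cong refl) (subst \<omega>_anti[OF assms], simp)
  finally show ?thesis .
qed

text \<open>On the Dirac domain these are the combinations of the constraints' Hamiltonian vectors
  that are dual to the gradients of the constraints.\<close>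

private definition u :: "real ^ 'n \<Rightarrow> 'n \<Rightarrow> 'c \<Rightarrow> real" where
  "u z i \<beta> = (\<Sum>\<alpha>\<in>UNIV. bracket \<omega> (\<lambda>y. y $ i) (\<Phi> \<alpha>) z * matrix_inv (M z) $ \<alpha> $ \<beta>)"

text \<open>On the Dirac domain this is the projector onto the tangent space of the level sets of
  \<Phi>, along the span of the constraints' Hamiltonian vectors.\<close>

private definition P :: "real ^ 'n \<Rightarrow> 'n \<Rightarrow> 'n \<Rightarrow> real" where
  "P z i a = (if a = i then 1 else 0) - (\<Sum>\<beta>\<in>UNIV. u z i \<beta> * partial a (\<Phi> \<beta>) z)"

private lemma differentiable_u:
  assumes "z \<in> D"
  shows "(\<lambda>y. u y i \<beta>) differentiable (at z)"
proof -
  have det: "det (M z) \<noteq> 0" and zU: "z \<in> U" using assms by (auto simp: dirac_domain_def)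
  have entry: "(\<lambda>y. (\<chi> a b. if b = \<alpha> then axis \<beta> 1 $ a else M y $ a $ b) $ a $ b) differentiable (at z)" for \<alpha> a b
    by (cases "b = \<alpha>") (simp_all add: differentiable_constraint_matrix zU)
  have "(\<lambda>y. matrix_inv (M y) $ \<alpha> $ \<beta>) differentiable (at z)" for \<alpha>
  proof -
    let ?g = "\<lambda>y. det (\<chi> a b. if b = \<alpha> then axis \<beta> 1 $ a else M y $ a $ b) / det (M y)"
    have "?g differentiable (at z)"
      by (intro differentiable_divide differentiable_det det entry differentiable_constraint_matrix zU)
    then obtain F where "(?g has_derivative F) (at z)"
      unfolding differentiable_def by blast
    \<comment> \<open>Cramer's quotient equals the inverse only where the determinant is nonzero;
      that set is open, so the derivative carries over.\<close>
    then have "((\<lambda>y. matrix_inv (M y) $ \<alpha> $ \<beta>) has_derivative F) (at z)"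
      by (rule has_derivative_transform_within_open[OF _ open_dirac_domain assms])
        (simp add: dirac_domain_def matrix_inv_component)
    then show ?thesis unfolding differentiable_def by blast
  qed
  then show ?thesis
    unfolding u_def bracket_component_left
    by (simp add: differentiable_\<omega> differentiable_\<Phi> zU)
qed

private lemma differentiable_P: "z \<in> D \<Longrightarrow> (\<lambda>y. P y i a) differentiable (at z)"
  unfolding P_def by (simp add: differentiable_u differentiable_\<Phi> dirac_domainD)

text \<open>A regrouping of the defining sums, valid at every \<open>z\<close> and therefore usable
  under a lambda.\<close>

private lemma dirac_tensor_left: "T z $ i $ j = (\<Sum>a\<in>UNIV. P z i a * \<omega> z $ a $ j)"
proof -
  have 1: "bracket \<omega> (\<lambda>y. y $ i) (\<lambda>y. y $ j) z = \<omega> z $ i $ j"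
    by (simp add: bracket_component_left partial_component if_distrib cong: if_cong)
  have "T z $ i $ j = \<omega> z $ i $ j - (\<Sum>\<beta>\<in>UNIV. u z i \<beta> * bracket \<omega> (\<Phi> \<beta>) (\<lambda>y. y $ j) z)"
    unfolding dirac_tensor_def u_def sum_distrib_right vec_lambda_beta 1 by (subst sum.swap) simp
  also have "(\<Sum>\<beta>\<in>UNIV. u z i \<beta> * bracket \<omega> (\<Phi> \<beta>) (\<lambda>y. y $ j) z)
      = (\<Sum>a\<in>UNIV. (\<Sum>\<beta>\<in>UNIV. u z i \<beta> * partial a (\<Phi> \<beta>) z) * \<omega> z $ a $ j)"
    unfolding bracket_component_right sum_distrib_left sum_distrib_right
    by (subst sum.swap) (simp add: mult.assoc)
  finally show ?thesis
    unfolding P_def left_diff_distrib sum_subtractf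
    by (simp add: if_distribR if_distrib cong: if_cong)
qed

text \<open>The correction term is the antisymmetric inverse matrix contracted on both sides with
  the same brackets \<open>?b\<close>.\<close>

lemma dirac_tensor_antisymmetric:
  assumes "z \<in> dirac_domain U \<omega> \<Phi>"
  shows "dirac_tensor \<omega> \<Phi> z $ i $ j = - dirac_tensor \<omega> \<Phi> z $ j $ i"
proof -
  let ?b = "\<lambda>i \<alpha>. bracket \<omega> (\<lambda>y. y $ i) (\<Phi> \<alpha>) z"
  have zU: "z \<in> U" using assms dirac_domainD by blast
  have right: "bracket \<omega> (\<Phi> \<beta>) (\<lambda>y. y $ j) z = - ?b j \<beta>" for \<beta> j
    unfolding bracket_component_left bracket_component_right \<omega>_anti[OF zU, of j]
    by (simp add: sum_negf mult.commute)
  have T_eq: "T z $ i $ j = \<omega> z $ i $ j + (\<Sum>\<alpha>\<in>UNIV. \<Sum>\<beta>\<in>UNIV. ?b i \<alpha> * matrix_inv (M z) $ \<alpha> $ \<beta> * ?b j \<beta>)" for i j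
  proof -
    have "bracket \<omega> (\<lambda>y. y $ i) (\<lambda>y. y $ j) z = \<omega> z $ i $ j"
      by (simp add: bracket_component_left partial_component if_distrib cong: if_cong)
    then show ?thesis unfolding dirac_tensor_def right by (simp add: sum_negf)
  qed
  have inv_anti: "matrix_inv (M z) $ \<alpha> $ \<beta> = - matrix_inv (M z) $ \<beta> $ \<alpha>" for \<alpha> \<beta>
    using assms dirac_domainD constraint_matrix_anti by (intro matrix_inv_antisymmetric) blast+
  have "(\<Sum>\<alpha>\<in>UNIV. \<Sum>\<beta>\<in>UNIV. ?b i \<alpha> * matrix_inv (M z) $ \<alpha> $ \<beta> * ?b j \<beta>)
      = (\<Sum>\<beta>\<in>UNIV. \<Sum>\<alpha>\<in>UNIV. - (?b j \<beta> * matrix_inv (M z) $ \<beta> $ \<alpha> * ?b i \<alpha>))"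
    by (subst sum.swap) (intro sum.cong refl, subst inv_anti, simp)
  then show ?thesis
    unfolding T_eq by (subst \<omega>_anti[OF zU]) (simp add: sum_negf)
qed

private lemma dirac_tensor_right:
  assumes "z \<in> D"
  shows "T z $ i $ j = (\<Sum>b\<in>UNIV. \<omega> z $ i $ b * P z j b)"
proof -
  have "T z $ i $ j = - (\<Sum>b\<in>UNIV. P z j b * \<omega> z $ b $ i)"
    by (subst dirac_tensor_antisymmetric[OF assms]) (simp only: dirac_tensor_left)
  then show ?thesis
    unfolding \<omega>_anti[OF dirac_domainD(1)[OF assms], of i]
    by (simp add: sum_negf mult.commute)
qed

text \<open>The constraints are Casimir functions of the Dirac bracket: contracting \<open>u\<close>
  with \<open>M\<close> cancels the inverse, so the correction exactly removes the bracket with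
  \<open>\<Phi> \<gamma>\<close>.\<close>

private lemma dirac_tensor_kills_constraints:
  assumes "z \<in> D"
  shows "(\<Sum>a\<in>UNIV. T z $ i $ a * partial a (\<Phi> \<gamma>) z) = 0"
proof -
  let ?b = "\<lambda>i \<alpha>. bracket \<omega> (\<lambda>y. y $ i) (\<Phi> \<alpha>) z"
  have "(\<Sum>\<beta>\<in>UNIV. u z i \<beta> * M z $ \<beta> $ \<gamma>)
      = (\<Sum>\<alpha>\<in>UNIV. ?b i \<alpha> * (matrix_inv (M z) ** M z) $ \<alpha> $ \<gamma>)"
    unfolding u_def matrix_matrix_mult_def sum_distrib_right
    by (subst sum.swap) (simp add: sum_distrib_left mult.assoc)
  also have "\<dots> = ?b i \<gamma>"
    unfolding matrix_inv_cancel(2)[OF dirac_domainD(2)[OF assms]]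
    by (simp add: mat_def if_distrib cong: if_cong)
  finally have uM: "(\<Sum>\<beta>\<in>UNIV. u z i \<beta> * M z $ \<beta> $ \<gamma>) = ?b i \<gamma>" .
  have "(\<Sum>a\<in>UNIV. T z $ i $ a * partial a (\<Phi> \<gamma>) z) = (\<Sum>a\<in>UNIV. P z i a * ?b a \<gamma>)"
    unfolding dirac_tensor_left bracket_component_left sum_distrib_right sum_distrib_left
    by (subst sum.swap) (simp add: mult.assoc)
  also have "\<dots> = ?b i \<gamma> - (\<Sum>a\<in>UNIV. \<Sum>\<beta>\<in>UNIV. u z i \<beta> * (partial a (\<Phi> \<beta>) z * ?b a \<gamma>))"
    unfolding P_def left_diff_distrib sum_subtractf sum_distrib_right
    by (simp add: mult.assoc if_distribR if_distrib cong: if_cong)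
  also have "(\<Sum>a\<in>UNIV. \<Sum>\<beta>\<in>UNIV. u z i \<beta> * (partial a (\<Phi> \<beta>) z * ?b a \<gamma>))
      = (\<Sum>\<beta>\<in>UNIV. u z i \<beta> * M z $ \<beta> $ \<gamma>)"
    unfolding bracket_component_left constraint_matrix_def bracket_def
    by (subst sum.swap) (simp add: sum_distrib_left mult.assoc)
  finally show ?thesis by (simp add: uM)
qed

text \<open>Applying \<open>P\<close> to \<open>T\<close> changes nothing, since \<open>P\<close>
  differs from the identity by gradients of constraints, which \<open>T\<close> annihilates. In this
  form every derivative of \<open>P\<close> meets a factor that combines to
  \<open>T\<close>.\<close>

private lemma dirac_tensor_sandwich:
  assumes "z \<in> D"
  shows "T z $ i $ j = (\<Sum>a\<in>UNIV. \<Sum>b\<in>UNIV. P z i a * \<omega> z $ a $ b * P z j b)"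
proof -
  have kill: "(\<Sum>a\<in>UNIV. partial a (\<Phi> \<beta>) z * T z $ a $ j) = 0" for \<beta>
    unfolding dirac_tensor_antisymmetric[OF assms, of _ j]
    using dirac_tensor_kills_constraints[OF assms, of j \<beta>] by (simp add: sum_negf mult.commute)
  have "(\<Sum>a\<in>UNIV. \<Sum>b\<in>UNIV. P z i a * \<omega> z $ a $ b * P z j b) = (\<Sum>a\<in>UNIV. P z i a * T z $ a $ j)"
    unfolding dirac_tensor_right[OF assms] by (simp add: sum_distrib_left mult.assoc)
  also have "\<dots> = T z $ i $ j - (\<Sum>a\<in>UNIV. \<Sum>\<beta>\<in>UNIV. u z i \<beta> * (partial a (\<Phi> \<beta>) z * T z $ a $ j))"
    unfolding P_def left_diff_distrib sum_subtractf sum_distrib_right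
    by (simp add: mult.assoc if_distribR if_distrib cong: if_cong)
  also have "(\<Sum>a\<in>UNIV. \<Sum>\<beta>\<in>UNIV. u z i \<beta> * (partial a (\<Phi> \<beta>) z * T z $ a $ j)) = 0"
    by (subst sum.swap) (simp add: sum_distrib_left[symmetric] kill)
  finally show ?thesis by simp
qed

lemma differentiable_dirac_tensor:
  assumes "z \<in> dirac_domain U \<omega> \<Phi>"
  shows "(\<lambda>y. dirac_tensor \<omega> \<Phi> y $ i $ j) differentiable (at z)"
  unfolding dirac_tensor_left
  using assms by (simp add: differentiable_P differentiable_\<omega> dirac_domainD)

lemma jacobi_dirac_tensor:
  assumes "z \<in> dirac_domain U \<omega> \<Phi>"
  shows "jacobi_tensor_at (dirac_tensor \<omega> \<Phi>) z"
proof -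
  have zU: "z \<in> U" using assms dirac_domainD by blast
  note d = differentiable_P[OF assms] differentiable_\<omega>[OF zU] differentiable_u[OF assms] differentiable_\<Phi>[OF zU]
  have dP: "partial p (\<lambda>y. P y i a) z = - (\<Sum>\<beta>\<in>UNIV. partial p (\<lambda>y. u y i \<beta>) z * partial a (\<Phi> \<beta>) z
      + u z i \<beta> * partial p (partial a (\<Phi> \<beta>)) z)" for p i a
    unfolding P_def by (simp add: partial_diff partial_sum partial_mult partial_const d)
  have dT: "partial p (\<lambda>y. T y $ i $ j) z = (\<Sum>a\<in>UNIV. \<Sum>b\<in>UNIV.
      partial p (\<lambda>y. P y i a) z * \<omega> z $ a $ b * P z j b
      + P z i a * partial p (\<lambda>y. \<omega> y $ a $ b) z * P z j b
      + P z i a * \<omega> z $ a $ b * partial p (\<lambda>y. P y j b) z)" for p i j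
  proof -
    \<comment> \<open>The sandwich form is known only on the Dirac domain, so it is substituted
      under \<open>partial\<close> by locality.\<close>
    have "partial p (\<lambda>y. T y $ i $ j) z
        = partial p (\<lambda>y. \<Sum>a\<in>UNIV. \<Sum>b\<in>UNIV. P y i a * \<omega> y $ a $ b * P y j b) z"
      by (rule partial_cong_open[OF open_dirac_domain assms dirac_tensor_sandwich])
    then show ?thesis by (simp add: partial_sum partial_mult d distrib_right)
  qed
  have jac: "(\<Sum>p\<in>UNIV. \<omega> z $ i $ p * partial p (\<lambda>y. \<omega> y $ j $ k) z)
      + (\<Sum>p\<in>UNIV. \<omega> z $ j $ p * partial p (\<lambda>y. \<omega> y $ k $ i) z)
      + (\<Sum>p\<in>UNIV. \<omega> z $ k $ p * partial p (\<lambda>y. \<omega> y $ i $ j) z) = 0" for i j k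
    using poisson zU unfolding poisson_tensor_on_def jacobi_tensor_at_def by blast
  show ?thesis
    unfolding jacobi_tensor_at_def
    by (intro allI, rule projected_tensor_jacobi[where w = "\<lambda>i j. \<omega> z $ i $ j"
        and T = "\<lambda>i j. T z $ i $ j" and P = "P z" and u = "u z" and v = "\<lambda>\<beta> a. partial a (\<Phi> \<beta>) z"
        and h = "\<lambda>\<beta> p a. partial p (partial a (\<Phi> \<beta>)) z"
        and dP = "\<lambda>p i a. partial p (\<lambda>y. P y i a) z" and du = "\<lambda>p i \<beta>. partial p (\<lambda>y. u y i \<beta>) z"
        and dw = "\<lambda>p a b. partial p (\<lambda>y. \<omega> y $ a $ b) z"
        and dT = "\<lambda>p i j. partial p (\<lambda>y. T y $ i $ j) z"])
      (rule dirac_tensor_left dirac_tensor_right[OF assms] dirac_tensor_antisymmetric[OF assms]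
      dirac_tensor_kills_constraints[OF assms] partial_partial_commute[OF smooth_\<Phi> openU zU] dP dT jac)+
qed

end

theorem mainTheorem4:
  fixes U :: "(real ^ 'n) set"
    and \<omega> :: "real ^ 'n \<Rightarrow> real ^ 'n ^ 'n"
    and \<Phi> :: "'c::finite \<Rightarrow> real ^ 'n \<Rightarrow> real"
    and k :: nat
  assumes "open U"
    and "poisson_tensor_on U \<omega>"
    and "nondegenerate_on U \<omega>"
    and "k \<le> CARD('n)" and "CARD('c) = CARD('n) - k"
    and "\<And>\<alpha>. smooth_on U (\<Phi> \<alpha>)"
    and "functionally_independent_on U \<Phi>"
    and "\<And>z. z \<in> constraint_surface U \<Phi> \<Longrightarrow> det (constraint_matrix \<omega> \<Phi> z) \<noteq> 0"
  shows "open (dirac_domain U \<omega> \<Phi>) \<and> constraint_surface U \<Phi> \<subseteq> dirac_domain U \<omega> \<Phi> \<and>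
    (\<forall>z \<in> dirac_domain U \<omega> \<Phi>. jacobi_tensor_at (dirac_tensor \<omega> \<Phi>) z) \<and>
    (\<forall>W A B C. open W \<and> W \<subseteq> dirac_domain U \<omega> \<Phi> \<and>
        smooth_on W A \<and> smooth_on W B \<and> smooth_on W C \<longrightarrow>
      (\<forall>z \<in> W.
          dirac_bracket \<omega> \<Phi> A (dirac_bracket \<omega> \<Phi> B C) z
        + dirac_bracket \<omega> \<Phi> B (dirac_bracket \<omega> \<Phi> C A) z
        + dirac_bracket \<omega> \<Phi> C (dirac_bracket \<omega> \<Phi> A B) z = 0))"
proof (intro conjI allI impI ballI)
  note poisson = assms(1,2,6)
  show "open (dirac_domain U \<omega> \<Phi>)"
    by (rule open_dirac_domain[OF poisson])
  \<comment> \<open>Together with openness, this makes the Dirac domain a neighbourhood of the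
    constraint surface.\<close>
  show "constraint_surface U \<Phi> \<subseteq> dirac_domain U \<omega> \<Phi>"
    using assms(8) by (auto simp: constraint_surface_def dirac_domain_def)
  show "jacobi_tensor_at (dirac_tensor \<omega> \<Phi>) z" if "z \<in> dirac_domain U \<omega> \<Phi>" for z
    by (rule jacobi_dirac_tensor[OF poisson that])
  fix W A B C z
  assume W: "open W \<and> W \<subseteq> dirac_domain U \<omega> \<Phi> \<and> smooth_on W A \<and> smooth_on W B \<and> smooth_on W C"
    and z: "z \<in> W"
  then have zD: "z \<in> dirac_domain U \<omega> \<Phi>" by blast
  show "dirac_bracket \<omega> \<Phi> A (dirac_bracket \<omega> \<Phi> B C) z
      + dirac_bracket \<omega> \<Phi> B (dirac_bracket \<omega> \<Phi> C A) z
      + dirac_bracket \<omega> \<Phi> C (dirac_bracket \<omega> \<Phi> A B) z = 0"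
    unfolding dirac_bracket_def
  proof (rule bracket_jacobi[of W])
    show "open W" "z \<in> W" "smooth_on W A" "smooth_on W B" "smooth_on W C"
      using W z by auto
    show "jacobi_tensor_at (dirac_tensor \<omega> \<Phi>) z"
      by (rule jacobi_dirac_tensor[OF poisson zD])
    show "dirac_tensor \<omega> \<Phi> z $ i $ j = - dirac_tensor \<omega> \<Phi> z $ j $ i" for i j
      by (rule dirac_tensor_antisymmetric[OF poisson zD])
    show "(\<lambda>y. dirac_tensor \<omega> \<Phi> y $ i $ j) differentiable (at z)" for i j
      by (rule differentiable_dirac_tensor[OF poisson zD])
  qed
qed

end
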